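(* Let $p$ be an odd prime and let $G$ be a finite group that is $p$-stable. Let $H$ be a subgroup of $G$. Then $H$ is $p$-stable.
   Context: A finite group $G$ is called $p$-stable (Glauberman 1971) if for every $p$-subgroup $Q$ of $G$ and every $x \in N_G(Q)$ with $[Q,x,x]=1$ (i.e. $[[a,x],x]=1$ for all $a\in Q$), the coset $xC_G(Q)$ lies in $O_p\big(N_G(Q)/C_G(Q)\big)$. *)

theory Defs
  imports "HOL-Algebra.Algebra"
begin

definition centralizer :: "('a, 'b) monoid_scheme \<Rightarrow> 'a set \<Rightarrow> 'a set" where
  "centralizer G S = {g \<in> carrier G. \<forall>s\<in>S. g \<otimes>\<^bsub>G\<^esub> s = s \<otimes>\<^bsub>G\<^esub> g}"

text \<open>The convention is \<open>[a, x] = a\<inverse>x\<inverse>ax\<close>. For \<open>x\<close> normalizing a subgroup \<open>Q\<close>, the condition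
  \<open>[[a, x], x] = 1\<close> for all \<open>a \<in> Q\<close> is the same for the convention \<open>axa\<inverse>x\<inverse>\<close>.\<close>

definition group_commutator :: "('a, 'b) monoid_scheme \<Rightarrow> 'a \<Rightarrow> 'a \<Rightarrow> 'a" where
  "group_commutator G a x = inv\<^bsub>G\<^esub> a \<otimes>\<^bsub>G\<^esub> inv\<^bsub>G\<^esub> x \<otimes>\<^bsub>G\<^esub> a \<otimes>\<^bsub>G\<^esub> x"

definition p_subgroup :: "nat \<Rightarrow> 'a set \<Rightarrow> ('a, 'b) monoid_scheme \<Rightarrow> bool" where
  "p_subgroup p Q G \<longleftrightarrow> subgroup Q G \<and> (\<exists>n. card Q = p ^ n)"

text \<open>\<open>O\<^sub>p(G)\<close>, the join of all normal \<open>p\<close>-subgroups; for finite \<open>G\<close> and prime \<open>p\<close> this is the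
  largest normal \<open>p\<close>-subgroup of \<open>G\<close>.\<close>

definition p_core :: "nat \<Rightarrow> ('a, 'b) monoid_scheme \<Rightarrow> 'a set" where
  "p_core p G = generate G (\<Union>{N. N \<lhd> G \<and> p_subgroup p N G})"

text \<open>Only meaningful for finite groups \<open>G\<close>.\<close>

definition p_stable :: "nat \<Rightarrow> ('a, 'b) monoid_scheme \<Rightarrow> bool" where
  "p_stable p G \<longleftrightarrow>
    (\<forall>Q x. p_subgroup p Q G \<longrightarrow> x \<in> normalizer G Q \<longrightarrow>
      (\<forall>a\<in>Q. group_commutator G (group_commutator G a x) x = \<one>\<^bsub>G\<^esub>) \<longrightarrow>
      x <#\<^bsub>G\<^esub> centralizer G Q
        \<in> p_core p (G\<lparr>carrier := normalizer G Q\<rparr> Mod centralizer G Q))"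

end

theory Submission
  imports Defs
begin

text \<open>For a \<open>p\<close>-subgroup \<open>Q\<close> of \<open>H\<close> one has \<open>N\<^sub>H(Q) = N\<^sub>G(Q) \<inter> H\<close> and \<open>C\<^sub>H(Q) = C\<^sub>G(Q) \<inter> H\<close>, so
  \<open>N\<^sub>H(Q) / C\<^sub>H(Q)\<close> embeds into \<open>N\<^sub>G(Q) / C\<^sub>G(Q)\<close> by \<open>x C\<^sub>H(Q) \<mapsto> x C\<^sub>G(Q)\<close>. The preimage of \<open>O\<^sub>p\<close>
  under an injective homomorphism of finite groups is a normal \<open>p\<close>-subgroup, hence lies in
  \<open>O\<^sub>p\<close> of the source.\<close>

section \<open>The largest normal p-subgroup of a finite group and its preimages\<close>

text \<open>By the second isomorphism theorem \<open>M <#> N\<close> modulo \<open>M\<close> is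
  isomorphic to \<open>N\<close> modulo \<open>M \<inter> N\<close>. Hence the order of the product
  is the order of \<open>M\<close> times a divisor of the order of \<open>N\<close>, and a divisor
  of a power of the prime \<open>p\<close> is again such a power.\<close>

lemma (in group) normal_p_subgroup_set_mult:
  assumes p: "Factorial_Ring.prime (p::nat)"
    and M: "M \<lhd> G" "p_subgroup p M G" and N: "p_subgroup p N G"
  shows "p_subgroup p (M <#> N) G"
proof -
  have sM: "subgroup M G" and sN: "subgroup N G"
    using M N by (auto simp: p_subgroup_def)
  obtain a b where ab: "card M = p ^ a" "card N = p ^ b"
    using M N by (auto simp: p_subgroup_def)
  interpret S: second_isomorphism_grp M G N
    using M sN by (simp add: second_isomorphism_grp_def second_isomorphism_grp_axioms_def)
  let ?MN = "G\<lparr>carrier := M <#> N\<rparr>" and ?N = "G\<lparr>carrier := N\<rparr>"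
  have sMN: "subgroup (M <#> N) G"
    by (rule S.normal_set_mult_subgroup)
  have "card (carrier (?N Mod (M \<inter> N))) = card (carrier (?MN Mod M))"
    using S.normal_intersection_quotient_isom bij_betw_same_card by (auto simp: iso_def)
  then have cosets: "card (rcosets\<^bsub>?N\<^esub> (M \<inter> N)) = card (rcosets\<^bsub>?MN\<^esub> M)"
    by (simp add: FactGroup_def)
  have "card (rcosets\<^bsub>?MN\<^esub> M) * card M = card (M <#> N)"
    using group.lagrange[OF subgroup_imp_group[OF sMN], of M]
      subgroup_incl[OF sM sMN S.H_contained_in_set_mult]
    by (simp add: order_def)
  moreover have "card (rcosets\<^bsub>?N\<^esub> (M \<inter> N)) * card (M \<inter> N) = card N"
    using group.lagrange[OF subgroup_imp_group[OF sN], of "M \<inter> N"]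
      subgroup_incl[OF subgroups_Inter_pair[OF sM sN] sN]
    by (simp add: order_def)
  ultimately have "card (M <#> N) dvd p ^ b * p ^ a"
    using cosets ab by (metis dvd_refl dvd_triv_left mult_dvd_mono)
  then have "\<exists>n. card (M <#> N) = p ^ n"
    using p by (metis divides_primepow_nat power_add)
  with sMN show ?thesis
    by (simp add: p_subgroup_def)
qed

text \<open>Take a normal p-subgroup \<open>N\<close> of maximal order. For any other one
  \<open>M\<close>, the product \<open>M <#> N\<close> is again in the family and contains
  \<open>N\<close>, so it equals \<open>N\<close>, and \<open>M\<close> lies in \<open>N\<close>.
  The union that generates \<open>p_core\<close> is therefore \<open>N\<close> itself.\<close>

lemma (in group) p_core_normal_p_subgroup:
  assumes fin: "finite (carrier G)" and p: "Factorial_Ring.prime (p::nat)"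
  shows "p_core p G \<lhd> G" "p_subgroup p (p_core p G) G"
proof -
  let ?S = "{N. N \<lhd> G \<and> p_subgroup p N G}"
  have sub: "?S \<subseteq> Pow (carrier G)"
    by (auto simp: p_subgroup_def dest: subgroup.mem_carrier)
  then have finS: "finite ?S"
    using fin by (meson finite_Pow_iff finite_subset)
  \<comment> \<open>The trivial subgroup makes the family nonempty, so that the maximal order is
    attained.\<close>
  have "card {\<one>} = p ^ 0"
    by simp
  then have one: "{\<one>} \<in> ?S"
    unfolding p_subgroup_def using one_is_normal triv_subgroup by blast
  obtain N where N: "N \<in> ?S" and N_max: "Max (card ` ?S) = card N"
    by (rule obtains_MAX[OF finS, of card]) (use one in auto)
  have max: "card M \<le> card N" if "M \<in> ?S" for M
    using Max_ge[OF finite_imageI[OF finS] imageI[OF that], of card] unfolding N_max .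
  have "M \<subseteq> N" if M: "M \<in> ?S" for M
  proof -
    interpret S: second_isomorphism_grp M G N
      using M N by (auto simp: second_isomorphism_grp_def second_isomorphism_grp_axioms_def
          p_subgroup_def)
    have MN: "M <#> N \<in> ?S"
      using M N normal_subgroup_set_mult_closed normal_p_subgroup_set_mult[OF p] by auto
    then have "finite (M <#> N)"
      using sub fin finite_subset by blast
    then have "N = M <#> N"
      using card_seteq[OF _ S.S_contained_in_set_mult] max[OF MN] by blast
    then show ?thesis
      using S.H_contained_in_set_mult by blast
  qed
  then have "\<Union>?S = N"
    using N by blast
  moreover have "generate G N = N"
    using N generateI[of N N] by (auto simp: p_subgroup_def)
  ultimately have "p_core p G = N"
    by (simp add: p_core_def)
  with N show "p_core p G \<lhd> G" "p_subgroup p (p_core p G) G"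
    by auto
qed

text \<open>Injectivity gives the preimage of \<open>p_core p L\<close> the same order as its image,
  a subgroup of a p-group. Lagrange makes this a power of \<open>p\<close>, so the preimage is one
  of the subgroups generating \<open>p_core p K\<close>.\<close>

lemma p_core_reflect_inj_hom:
  assumes K: "group K" and L: "group L" and fin: "finite (carrier L)"
    and p: "Factorial_Ring.prime (p::nat)"
    and h: "h \<in> hom K L" and inj: "inj_on h (carrier K)"
    and y: "y \<in> carrier K" and hy: "h y \<in> p_core p L"
  shows "y \<in> p_core p K"
proof -
  interpret group_hom K L h
    using K L h by (simp add: group_hom_def group_hom_axioms_def)
  let ?P = "p_core p L" and ?N = "{x \<in> carrier K. h x \<in> p_core p L}"
  have nP: "?P \<lhd> L" and pP: "p_subgroup p ?P L"
    using H.p_core_normal_p_subgroup[OF fin p] by auto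
  then obtain n where n: "card ?P = p ^ n"
    by (auto simp: p_subgroup_def)
  have sP: "subgroup ?P L"
    using pP by (simp add: p_subgroup_def)
  have sN: "subgroup ?N K"
    by (rule G.subgroupI)
      (use sP in \<open>auto simp: subgroup.m_closed subgroup.m_inv_closed intro: subgroup.one_closed
         intro!: exI[of _ "\<one>\<^bsub>K\<^esub>"]\<close>)
  have nN: "?N \<lhd> K"
    using sN nP by (auto simp: G.normal_inv_iff H.normal_inv_iff)
  have "subgroup (h ` ?N) L"
    using sN by (rule subgroup_img_is_subgroup)
  then have "subgroup (h ` ?N) (L\<lparr>carrier := ?P\<rparr>)"
    by (rule H.subgroup_incl[OF _ sP]) auto
  then have "card (h ` ?N) dvd card ?P"
    using group.lagrange[OF H.subgroup_imp_group[OF sP], of "h ` ?N"]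
    by (simp add: order_def dvdI mult.commute eq_commute[of _ "card ?P"])
  moreover have "card (h ` ?N) = card ?N"
    by (rule card_image) (use inj in \<open>auto intro: inj_on_subset\<close>)
  ultimately have "\<exists>m. card ?N = p ^ m"
    using p n by (metis divides_primepow_nat)
  then have "?N \<subseteq> \<Union>{N. N \<lhd> K \<and> p_subgroup p N K}"
    using sN nN by (auto simp: p_subgroup_def)
  with y hy show ?thesis
    unfolding p_core_def by (blast intro: generate.incl)
qed

section \<open>Normalizers and centralizers, and their restriction to a subgroup\<close>

text \<open>The normalizer is defined as a stabilizer under an action restricted to subsets of the
  carrier; for such \<open>Q\<close> the restriction disappears.\<close>

lemma (in group) mem_normalizer_iff:
  assumes "Q \<subseteq> carrier G"
  shows "x \<in> normalizer G Q \<longleftrightarrow> x \<in> carrier G \<and> (x <# Q) #> inv x = Q"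
  using assms by (auto simp: normalizer_def stabilizer_def)

lemma (in group) normalizer_restrict:
  assumes "subgroup H G" and "Q \<subseteq> H"
  shows "normalizer (G\<lparr>carrier := H\<rparr>) Q = normalizer G Q \<inter> H"
proof -
  have "Q \<subseteq> carrier G"
    using assms subgroup.subset by blast
  moreover have "group (G\<lparr>carrier := H\<rparr>)"
    using assms by (simp add: subgroup_imp_group)
  ultimately show ?thesis
    using assms
    by (auto simp: mem_normalizer_iff group.mem_normalizer_iff[of "G\<lparr>carrier := H\<rparr>"]
        subgroup.mem_carrier)
qed

lemma (in group) centralizer_restrict:
  assumes "subgroup H G"
  shows "centralizer (G\<lparr>carrier := H\<rparr>) Q = centralizer G Q \<inter> H"
  using assms by (auto simp: centralizer_def subgroup.mem_carrier)

lemma (in group) conj_eq_iff_commute: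
  assumes "x \<in> carrier G" "a \<in> carrier G"
  shows "x \<otimes> a \<otimes> inv x = a \<longleftrightarrow> x \<otimes> a = a \<otimes> x"
  using assms by (metis inv_solve_right m_closed)

lemma (in group) normalizer_conj_mem:
  assumes "Q \<subseteq> carrier G" "x \<in> normalizer G Q" "a \<in> Q"
  shows "x \<otimes> a \<otimes> inv x \<in> Q"
  using assms unfolding mem_normalizer_iff[OF assms(1)] l_coset_def r_coset_def by blast

text \<open>The centralizer is the kernel of the action of the normalizer on \<open>Q\<close> by
  conjugation. This is checked by hand: \<open>C_conj\<close> describes it as the set of elements
  fixing \<open>Q\<close> pointwise, and \<open>conj_mult\<close> composes conjugations.\<close>

lemma (in group) centralizer_normal_normalizer:
  assumes Q: "subgroup Q G"
  shows "centralizer G Q \<lhd> G\<lparr>carrier := normalizer G Q\<rparr>"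
proof -
  let ?N = "normalizer G Q" and ?C = "centralizer G Q"
  have QG: "Q \<subseteq> carrier G"
    using Q by (rule subgroup.subset)
  have sN: "subgroup ?N G"
    using QG by (rule normalizer_imp_subgroup)
  interpret N: group "G\<lparr>carrier := ?N\<rparr>"
    using sN by (rule subgroup_imp_group)
  have C_conj: "x \<in> ?C \<longleftrightarrow> x \<in> carrier G \<and> (\<forall>a\<in>Q. x \<otimes> a \<otimes> inv x = a)" for x
    using QG by (auto simp: centralizer_def conj_eq_iff_commute subset_iff)
  have conj_mult: "(x \<otimes> y) \<otimes> a \<otimes> inv (x \<otimes> y) = x \<otimes> (y \<otimes> a \<otimes> inv y) \<otimes> inv x"
    if "x \<in> carrier G" "y \<in> carrier G" "a \<in> carrier G" for x y a
    using that by (simp add: inv_mult_group m_assoc)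
  have sC: "subgroup ?C G"
  proof (rule subgroupI)
    show "?C \<subseteq> carrier G"
      by (auto simp: centralizer_def)
    have "\<one> \<in> ?C"
      using QG by (auto simp: C_conj subset_iff)
    then show "?C \<noteq> {}"
      by blast
    show "inv x \<in> ?C" if "x \<in> ?C" for x
    proof -
      have "inv x \<otimes> a \<otimes> inv (inv x) = a" if "a \<in> Q" for a
        using \<open>x \<in> ?C\<close> that QG conj_mult[of "inv x" x a] by (simp add: C_conj subset_iff)
      then show ?thesis
        using that by (simp add: C_conj)
    qed
    show "x \<otimes> y \<in> ?C" if "x \<in> ?C" "y \<in> ?C" for x y
      using that QG conj_mult[of x y] by (auto simp: C_conj subset_iff)
  qed
  have "?C \<subseteq> ?N"
  proof
    fix x assume "x \<in> ?C"
    then have x: "x \<in> carrier G" "\<And>a. a \<in> Q \<Longrightarrow> x \<otimes> a \<otimes> inv x = a"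
      by (auto simp: C_conj)
    then have "(x <# Q) #> inv x = Q"
      by (auto simp: l_coset_def r_coset_def)
    with x show "x \<in> ?N"
      by (simp add: mem_normalizer_iff[OF QG])
  qed
  moreover have "x \<otimes> c \<otimes> inv x \<in> ?C" if x: "x \<in> ?N" and c: "c \<in> ?C" for x c
  proof -
    have xG: "x \<in> carrier G" and cG: "c \<in> carrier G"
      using x c by (auto simp: C_conj mem_normalizer_iff[OF QG])
    have "(x \<otimes> c \<otimes> inv x) \<otimes> a \<otimes> inv (x \<otimes> c \<otimes> inv x) = a" if a: "a \<in> Q" for a
    proof -
      have aG: "a \<in> carrier G"
        using a QG by blast
      \<comment> \<open>Moving \<open>a\<close> by \<open>inv x\<close> stays inside
        \<open>Q\<close>, where \<open>c\<close> acts trivially; moving back by \<open>x\<close>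
        then returns \<open>a\<close>.\<close>
      have "inv x \<in> ?N"
        using sN x by (rule subgroup.m_inv_closed)
      then have "inv x \<otimes> a \<otimes> inv (inv x) \<in> Q"
        using QG a by (blast intro: normalizer_conj_mem)
      then have "c \<otimes> (inv x \<otimes> a \<otimes> inv (inv x)) \<otimes> inv c = inv x \<otimes> a \<otimes> inv (inv x)"
        using c by (simp add: C_conj)
      then have "(x \<otimes> c \<otimes> inv x) \<otimes> a \<otimes> inv (x \<otimes> c \<otimes> inv x)
          = x \<otimes> (inv x \<otimes> a \<otimes> inv (inv x)) \<otimes> inv x"
        using xG cG aG by (simp add: conj_mult)
      also have "\<dots> = a"
        using xG aG conj_mult[of x "inv x" a] by simp
      finally show ?thesis .
    qed
    then show ?thesis
      using xG cG by (simp add: C_conj)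
  qed
  ultimately show ?thesis
    using sN sC by (simp add: N.normal_inv_iff subgroup_incl)
qed

section \<open>Embedding of quotients and descent of p-stability\<close>

text \<open>The coset map of \<open>C\<close> restricted to \<open>H\<close> has kernel
  \<open>C \<inter> H\<close>, so it induces an embedding of the quotients, along which membership
  in \<open>p_core\<close> is reflected.\<close>

lemma (in group) p_core_Mod_restrict:
  assumes fin: "finite (carrier G)" and p: "Factorial_Ring.prime (p::nat)"
    and C: "C \<lhd> G" and H: "subgroup H G"
    and x: "x \<in> H" and core: "C #> x \<in> p_core p (G Mod C)"
  shows "(C \<inter> H) #> x \<in> p_core p (G\<lparr>carrier := H\<rparr> Mod (C \<inter> H))"
proof -
  interpret C: normal C G by fact
  let ?H = "G\<lparr>carrier := H\<rparr>" and ?L = "G Mod C" and ?q = "\<lambda>a. C #> a"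
  have HG: "H \<subseteq> carrier G"
    using H by (rule subgroup.subset)
  have q: "?q \<in> hom G ?L"
    by (rule C.r_coset_hom_Mod)
  then have "?q \<in> hom ?H ?L"
    using HG by (simp add: hom_def Pi_iff subset_iff)
  then interpret q: group_hom ?H ?L ?q
    using H C.factorgroup_is_group
    by (simp add: group_hom_def group_hom_axioms_def subgroup_imp_group)
  have ker: "kernel ?H ?L ?q = C \<inter> H"
    using HG C.subgroup_axioms C.subset
    by (auto simp: kernel_def coset_join2 dest: coset_join1[rotated 2])
  let ?X = "(C \<inter> H) #> x"
  \<comment> \<open>The induced map takes the only value of \<open>?q\<close> on a coset. To
    evaluate it at \<open>?X\<close>, the image must be shown to be a singleton: \<open>C\<close>
    absorbs the factors from \<open>C \<inter> H\<close>.\<close>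
  let ?h = "\<lambda>Y. the_elem (?q ` Y)"
  have X: "?X \<in> carrier (?H Mod (C \<inter> H))"
    using x by (auto simp: carrier_FactGroup)
  have "x \<in> ?X"
    using C.one_closed subgroup.one_closed[OF H] x HG
    by (auto simp: r_coset_def intro!: bexI[of _ \<one>])
  moreover have "?q a = ?q x" if "a \<in> ?X" for a
    using that x HG C.subset C.rcos_const
    by (auto simp: r_coset_def[of G "C \<inter> H"] subset_iff simp flip: coset_mult_assoc)
  ultimately have "?q ` ?X = {?q x}"
    by blast
  then have hX: "?h ?X = ?q x"
    by simp
  show ?thesis
  proof (rule p_core_reflect_inj_hom[where h = ?h and L = ?L])
    show "group (?H Mod (C \<inter> H))"
      using q.normal_kernel ker normal.factorgroup_is_group by metis
    show "group ?L"
      by (rule C.factorgroup_is_group)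
    show "finite (carrier ?L)"
      using fin by (simp add: carrier_FactGroup)
    show "?h \<in> hom (?H Mod (C \<inter> H)) ?L"
      using q.FactGroup_hom by (simp add: ker)
    show "inj_on ?h (carrier (?H Mod (C \<inter> H)))"
      using q.FactGroup_inj_on by (simp add: ker)
    show "?h ?X \<in> p_core p ?L"
      using core by (simp add: hX)
  qed (use p X in auto)
qed

theorem proposition1p8:
  fixes G :: "('a, 'b) monoid_scheme" and H :: "'a set" and p :: nat
  assumes "Factorial_Ring.prime p" and "odd p"
    and "group G" and "finite (carrier G)"
    and "p_stable p G"
    and "subgroup H G"
  shows "p_stable p (G\<lparr>carrier := H\<rparr>)"
  unfolding p_stable_def
proof (intro allI impI)
  interpret group G by fact
  let ?H = "G\<lparr>carrier := H\<rparr>"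
  fix Q x
  assume Q: "p_subgroup p Q ?H" and x: "x \<in> normalizer ?H Q"
    and comm: "\<forall>a\<in>Q. group_commutator ?H (group_commutator ?H a x) x = \<one>\<^bsub>?H\<^esub>"
  let ?N = "normalizer G Q" and ?C = "centralizer G Q"
  have QH: "Q \<subseteq> H"
    using Q subgroup.subset by (fastforce simp: p_subgroup_def)
  have sQ: "subgroup Q G"
    using Q incl_subgroup[OF \<open>subgroup H G\<close>] by (simp add: p_subgroup_def)
  have N_H: "normalizer ?H Q = ?N \<inter> H" and C_H: "centralizer ?H Q = ?C \<inter> H"
    using \<open>subgroup H G\<close> QH by (simp_all add: normalizer_restrict centralizer_restrict)
  have xN: "x \<in> ?N" and xH: "x \<in> H"
    using x by (auto simp: N_H)
  have sN: "subgroup ?N G"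
    using subgroup.subset[OF sQ] by (rule normalizer_imp_subgroup)
  have sNH: "subgroup (?N \<inter> H) G"
    using sN \<open>subgroup H G\<close> by (rule subgroups_Inter_pair)
  have nC: "?C \<lhd> G\<lparr>carrier := ?N\<rparr>"
    using sQ by (rule centralizer_normal_normalizer)
  have CN: "?C \<subseteq> ?N"
    using subgroup.subset[OF normal_imp_subgroup[OF nC]] by simp
  \<comment> \<open>The inner commutator stays in \<open>H\<close>, so both the inner and the outer
    one have the same value in \<open>?H\<close> and in \<open>G\<close>.\<close>
  have "group_commutator G (group_commutator G a x) x = \<one>\<^bsub>G\<^esub>" if "a \<in> Q" for a
  proof -
    have restrict: "group_commutator ?H b x = group_commutator G b x" if "b \<in> H" for b
      using that xH \<open>subgroup H G\<close> by (simp add: group_commutator_def)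
    have "a \<in> H"
      using that QH by blast
    moreover from this have "group_commutator G a x \<in> H"
      using xH \<open>subgroup H G\<close>
      by (auto simp: group_commutator_def intro!: subgroup.m_closed subgroup.m_inv_closed)
    ultimately show ?thesis
      using comm that by (auto simp: restrict)
  qed
  then have "x <#\<^bsub>G\<^esub> ?C \<in> p_core p (G\<lparr>carrier := ?N\<rparr> Mod ?C)"
    using \<open>p_stable p G\<close> sQ Q xN by (simp add: p_stable_def p_subgroup_def)
  \<comment> \<open>\<open>p_stable\<close> speaks of left cosets, the quotient lemma of right ones;
    normality in the normalizer identifies them.\<close>
  moreover have "x <#\<^bsub>G\<^esub> ?C = ?C #>\<^bsub>G\<^esub> x"
    using normal.coset_eq[OF nC] xN by simp
  \<comment> \<open>Here \<open>?N\<close> is the ambient group, \<open>?C\<close> its normal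
    subgroup, and \<open>?N \<inter> H\<close> the smaller group.\<close>
  ultimately have "(?C \<inter> (?N \<inter> H)) #>\<^bsub>G\<^esub> x \<in> p_core p (G\<lparr>carrier := ?N \<inter> H\<rparr> Mod (?C \<inter> (?N \<inter> H)))"
    using group.p_core_Mod_restrict[OF subgroup_imp_group[OF sN] _ \<open>Factorial_Ring.prime p\<close> nC
        subgroup_incl[OF sNH sN], of x]
      xN xH finite_subset[OF subgroup.subset[OF sN] \<open>finite (carrier G)\<close>] by simp
  moreover have "?C \<inter> (?N \<inter> H) = centralizer ?H Q"
    using CN C_H by blast
  \<comment> \<open>The way back to left cosets uses normality of the centralizer once more, now
    inside \<open>?H\<close>.\<close>
  moreover have "x <#\<^bsub>G\<^esub> centralizer ?H Q = centralizer ?H Q #>\<^bsub>G\<^esub> x"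
  proof -
    interpret H: group ?H
      using \<open>subgroup H G\<close> by (rule subgroup_imp_group)
    show ?thesis
      using normal.coset_eq[OF H.centralizer_normal_normalizer, of Q] Q x
      by (simp add: p_subgroup_def)
  qed
  ultimately show "x <#\<^bsub>?H\<^esub> centralizer ?H Q
      \<in> p_core p (?H\<lparr>carrier := normalizer ?H Q\<rparr> Mod centralizer ?H Q)"
    by (simp add: N_H)
qed

end
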